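(* Let $G$ be a $1$-John domain in $\mathbb{R}^n$, $n\ge2$. Then for every $1\le p<\infty$ and every $\delta,\tau\in(0,1)$, $G$ supports the fractional $(p,p)$-Poincaré inequality, i.e. there is $c<\infty$ such that for all $u\in L^p(G)$ \[ \int_G|u(x)-u_G|^p\,dx\le c\int_G\int_{G\cap B^n(x,\tau\operatorname{dist}(x,\partial G))}\frac{|u(x)-u(y)|^p}{|x-y|^{n+\delta p}}\,dy\,dx. \]
   Context: A bounded domain $G\subset\mathbb{R}^n$ is an $s$-John domain ($s\ge1$) if there are a point $x_0\in G$ and a constant $c>0$ such that every $x\in G$ can be joined to $x_0$ by a rectifiable curve $\gamma:[0,l]\to G$ parametrized by arc length with $\gamma(0)=x$, $\gamma(l)=x_0$, $l\le c$, and $\operatorname{dist}(\gamma(t),\partial G)\ge t^s/c$ for all $t\in[0,l]$. $u_G$ is the mean value of $u$ over $G$. *)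

theory Defs
  imports "HOL-Analysis.Analysis"
begin

definition curve_length :: "(real \<Rightarrow> 'a::metric_space) \<Rightarrow> real \<Rightarrow> real \<Rightarrow> ennreal" where
  "curve_length g a b =
     (SUP (k, t) \<in> {(k::nat, t::nat \<Rightarrow> real). t 0 = a \<and> t k = b \<and> (\<forall>i<k. t i \<le> t (Suc i))}.
        ennreal (\<Sum>i<k. dist (g (t (Suc i))) (g (t i))))"

definition arc_length_param :: "(real \<Rightarrow> 'a::metric_space) \<Rightarrow> real \<Rightarrow> bool" where
  "arc_length_param g l \<longleftrightarrow> 0 \<le> l \<and>
     (\<forall>a b. 0 \<le> a \<and> a \<le> b \<and> b \<le> l \<longrightarrow> curve_length g a b = ennreal (b - a))"

definition John_domain :: "real \<Rightarrow> 'a::euclidean_space set \<Rightarrow> bool" where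
  "John_domain s G \<longleftrightarrow> s \<ge> 1 \<and> open G \<and> connected G \<and> G \<noteq> {} \<and> bounded G \<and>
     (\<exists>x0\<in>G. \<exists>c>0. \<forall>x\<in>G. \<exists>g l. arc_length_param g l \<and> g ` {0..l} \<subseteq> G \<and>
         g 0 = x \<and> g l = x0 \<and> l \<le> c \<and>
         (\<forall>t\<in>{0..l}. infdist (g t) (frontier G) \<ge> t powr s / c))"

definition mean_value :: "('a::euclidean_space \<Rightarrow> real) \<Rightarrow> 'a set \<Rightarrow> real" where
  "mean_value u G = (\<integral>x\<in>G. u x \<partial>lebesgue) / measure lebesgue G"

definition in_Lp :: "real \<Rightarrow> 'a::euclidean_space set \<Rightarrow> ('a \<Rightarrow> real) \<Rightarrow> bool" where
  "in_Lp p G u \<longleftrightarrow> u \<in> borel_measurable (lebesgue_on G) \<and>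
     set_integrable lebesgue G (\<lambda>x. \<bar>u x\<bar> powr p)"

end

theory Submission
  imports Defs
begin

text \<open>
  Along the John curve of \<open>x\<close>, parametrised by \<open>s\<close>, place balls of radius \<open>\<epsilon> s\<close> with centres \<open>h s\<close> at the
  parameters \<open>s = R \<theta>^k\<close>, stopping once \<open>s\<close> is below \<open>\<tau> d(x) / 2\<close>, where \<open>d\<close> is the distance to the
  boundary; then \<open>u x\<close> can be compared directly with the mean of \<open>u\<close> over the last ball, and no
  differentiation theorem is needed. Let \<open>F\<close> be the inner integral of the right-hand side.
  On the balls of the chain \<open>d(y)\<close> and \<open>s\<close> are comparable, so the means over two
  consecutive balls differ by at most a multiple of \<open>s powr \<delta> * X powr (1/p)\<close> with
  \<open>X = \<integral> d(y)^(-n) F(y) dy\<close> over \<open>|x - y| < L d(y)\<close>. As \<open>\<delta> > 0\<close>, these bounds form a geometric series,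
  so \<open>|u(x) - a|^p \<le> C (F(x) + X)\<close> for the mean \<open>a\<close> over a fixed ball. Integrating over \<open>x\<close> and
  using Tonelli gives the claim, since \<open>|{x. |x - y| < L d(y)}|\<close> is a multiple of \<open>d(y)^n\<close>.
\<close>

section \<open>Jensen's inequality for mean values\<close>

text \<open>Convexity of t^p on the open half-line. The boundary cases \<open>m = 0\<close> and
  \<open>s = 0\<close> are checked by hand, because the derivative is taken inside
  \<open>{0<..}\<close> and the convention \<open>0 powr 0 = 0\<close> enters for
  \<open>p = 1\<close>.\<close>

lemma powr_above_tangent:
  fixes s m p :: real
  assumes "1 \<le> p" "0 \<le> s" "0 \<le> m"
  shows "m powr p + p * m powr (p - 1) * (s - m) \<le> s powr p"
proof (cases "m = 0 \<or> s = 0")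
  case True
  have "m powr (p - 1) * m = m powr p"
    using assms by (cases "m = 0") (auto simp: powr_mult_base powr_diff)
  moreover have "1 * m powr p \<le> p * m powr p"
    using assms by (intro mult_right_mono) auto
  ultimately show ?thesis
    using True assms by (auto simp: algebra_simps)
next
  case False
  then have pos: "0 < s" "0 < m" using assms by auto
  have "(\<lambda>x. x powr p) s - (\<lambda>x. x powr p) m \<ge> (p * m powr (p - 1)) * (s - m)"
  proof (rule convex_on_imp_above_tangent[where A="{0<..}"])
    show "convex_on {0<..} (\<lambda>x. x powr p)" using assms by (intro powr_convex)
    show "((\<lambda>x. x powr p) has_field_derivative p * m powr (p - 1)) (at m within {0<..})"
      using pos by (auto intro!: derivative_eq_intros)
  qed (use pos in \<open>auto simp: interior_open connected_imp_perfect\<close>)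
  then show ?thesis by simp
qed

text \<open>Jensen's inequality for t -> |t - c|^p: the supporting line at the mean is integrated
  over \<open>B\<close>, where its linear part contributes zero. The right-hand side may be
  infinite, so only \<open>f\<close> itself has to be integrable.\<close>

lemma powr_abs_mean_diff_le:
  fixes f :: "'a \<Rightarrow> real"
  assumes p: "1 \<le> p" and B: "B \<in> sets M" "emeasure M B \<noteq> \<infinity>" "measure M B > 0"
    and f: "set_integrable M B f"
  shows "ennreal (measure M B * \<bar>(LINT x:B|M. f x) / measure M B - c\<bar> powr p)
    \<le> (\<integral>\<^sup>+x\<in>B. ennreal (\<bar>f x - c\<bar> powr p) \<partial>M)"
proof -
  define m where "m = (LINT x:B|M. f x) / measure M B"
  \<comment> \<open>The slope of a supporting line of |t - c|^p at t = \<open>m\<close>; as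
    \<open>sgn 0 = 0\<close>, it is 0 at the vertex \<open>m = c\<close>.\<close>
  define k where "k = p * \<bar>m - c\<bar> powr (p - 1) * sgn (m - c)"
  have tangent: "\<bar>m - c\<bar> powr p + k * (t - m) \<le> \<bar>t - c\<bar> powr p" for t
  proof -
    have "sgn (m - c) * (t - m) \<le> \<bar>t - c\<bar> - \<bar>m - c\<bar>"
      by (auto simp: sgn_if abs_if)
    then have "p * \<bar>m - c\<bar> powr (p - 1) * (sgn (m - c) * (t - m))
        \<le> p * \<bar>m - c\<bar> powr (p - 1) * (\<bar>t - c\<bar> - \<bar>m - c\<bar>)"
      using p by (intro mult_left_mono) auto
    with powr_above_tangent[OF p, of "\<bar>t - c\<bar>" "\<bar>m - c\<bar>"] show ?thesis
      by (simp add: k_def mult.assoc)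
  qed
  show ?thesis
  proof (cases "(\<integral>\<^sup>+x\<in>B. ennreal (\<bar>f x - c\<bar> powr p) \<partial>M) = \<infinity>")
    case False
    have meas: "(\<lambda>x. indicator B x * f x) \<in> borel_measurable M"
      using f by (auto simp: set_integrable_def)
    \<comment> \<open>Integrability on \<open>B\<close> makes \<open>f\<close> measurable only after
      multiplication by the indicator. The inner indicator supplies this and is absorbed by the
      outer one.\<close>
    have "(\<lambda>x. indicator B x * \<bar>indicator B x * f x - c\<bar> powr p) \<in> borel_measurable M"
      using meas B by measurable
    also have "(\<lambda>x. indicator B x * \<bar>indicator B x * f x - c\<bar> powr p)
        = (\<lambda>x. indicator B x * \<bar>f x - c\<bar> powr p)"
      by (auto simp: fun_eq_iff indicator_def)
    finally have meas': "(\<lambda>x. indicator B x * \<bar>f x - c\<bar> powr p) \<in> borel_measurable M" .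
    have nn: "(\<integral>\<^sup>+x\<in>B. ennreal (\<bar>f x - c\<bar> powr p) \<partial>M)
        = (\<integral>\<^sup>+x. ennreal (indicator B x * \<bar>f x - c\<bar> powr p) \<partial>M)"
      by (intro nn_integral_cong) (auto simp: indicator_def)
    have int: "integrable M (\<lambda>x. indicator B x * \<bar>f x - c\<bar> powr p)"
      using False meas' by (intro integrableI_nonneg) (auto simp: nn top.not_eq_extremum)
    have const: "integrable M (\<lambda>x. indicator B x * a :: real)" for a
      using B by (intro integrable_mult_left) (auto simp: top.not_eq_extremum)
    have f': "integrable M (\<lambda>x. indicator B x * f x)"
      using f by (simp add: set_integrable_def)
    define a where "a = \<bar>m - c\<bar> powr p - k * m"
    have lin: "(\<lambda>x. indicator B x * (\<bar>m - c\<bar> powr p + k * (f x - m)))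
        = (\<lambda>x. indicator B x * a + k * (indicator B x * f x))"
      by (auto simp: fun_eq_iff indicator_def algebra_simps a_def)
    have "measure M B * \<bar>m - c\<bar> powr p
        = (\<integral>x. indicator B x * (\<bar>m - c\<bar> powr p + k * (f x - m)) \<partial>M)"
    proof -
      have "(LINT x:B|M. f x) = m * measure M B" using B by (simp add: m_def)
      then have "(\<integral>x. indicator B x * f x \<partial>M) = m * measure M B"
        by (simp add: set_lebesgue_integral_def)
      then have "(\<integral>x. indicator B x * a + k * (indicator B x * f x) \<partial>M) = measure M B * a + k * (m * measure M B)"
        using const f' B by (subst Bochner_Integration.integral_add) simp_all
      then show ?thesis
        unfolding lin by (simp add: a_def algebra_simps)
    qed
    also have "\<dots> \<le> (\<integral>x. indicator B x * \<bar>f x - c\<bar> powr p \<partial>M)"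
      using const f' tangent
      by (intro integral_mono int) (auto simp: lin intro!: Bochner_Integration.integrable_add split: split_indicator)
    finally have "ennreal (measure M B * \<bar>m - c\<bar> powr p) \<le> ennreal (\<integral>x. indicator B x * \<bar>f x - c\<bar> powr p \<partial>M)"
      by (rule ennreal_leI)
    also have "\<dots> = (\<integral>\<^sup>+x\<in>B. ennreal (\<bar>f x - c\<bar> powr p) \<partial>M)"
      unfolding nn using int by (intro nn_integral_eq_integral[symmetric]) auto
    finally show ?thesis by (simp add: m_def)
  qed simp
qed

text \<open>Jensen's inequality is used twice: over \<open>B\<close> against the mean over
  \<open>C\<close>, and then, for each fixed \<open>x\<close>, over \<open>C\<close> against the
  constant \<open>f x\<close>.\<close>

lemma powr_abs_mean_diff_mean_le:
  fixes f :: "'a \<Rightarrow> real"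
  assumes p: "1 \<le> p"
    and B: "B \<in> sets M" "emeasure M B \<noteq> \<infinity>" "measure M B > 0" "set_integrable M B f"
    and C: "C \<in> sets M" "emeasure M C \<noteq> \<infinity>" "measure M C > 0" "set_integrable M C f"
  shows "ennreal (measure M B * measure M C *
      \<bar>(LINT x:B|M. f x) / measure M B - (LINT x:C|M. f x) / measure M C\<bar> powr p)
    \<le> (\<integral>\<^sup>+x\<in>B. (\<integral>\<^sup>+y\<in>C. ennreal (\<bar>f x - f y\<bar> powr p) \<partial>M) \<partial>M)"
proof -
  define m where "m = (LINT x:C|M. f x) / measure M C"
  have "ennreal (measure M C * (measure M B * \<bar>(LINT x:B|M. f x) / measure M B - m\<bar> powr p))
      \<le> ennreal (measure M C) * (\<integral>\<^sup>+x\<in>B. ennreal (\<bar>f x - m\<bar> powr p) \<partial>M)"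
    using powr_abs_mean_diff_le[OF p B, of m] by (simp add: ennreal_mult mult_left_mono)
  also have "\<dots> = (\<integral>\<^sup>+x. ennreal (measure M C) * (ennreal (\<bar>f x - m\<bar> powr p) * indicator B x) \<partial>M)"
  proof -
    have "(\<lambda>x. indicator B x * f x) \<in> borel_measurable M"
      using B by (auto simp: set_integrable_def)
    then have "(\<lambda>x. ennreal (\<bar>indicator B x * f x - m\<bar> powr p) * indicator B x) \<in> borel_measurable M"
      using B by measurable
    also have "(\<lambda>x. ennreal (\<bar>indicator B x * f x - m\<bar> powr p) * indicator B x)
        = (\<lambda>x. ennreal (\<bar>f x - m\<bar> powr p) * indicator B x)"
      by (auto simp: fun_eq_iff indicator_def)
    finally show ?thesis by (intro nn_integral_cmult[symmetric])
  qed
  also have "\<dots> \<le> (\<integral>\<^sup>+x\<in>B. (\<integral>\<^sup>+y\<in>C. ennreal (\<bar>f x - f y\<bar> powr p) \<partial>M) \<partial>M)"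
  proof (intro nn_integral_mono)
    fix x
    have "ennreal (measure M C) * ennreal (\<bar>f x - m\<bar> powr p)
        \<le> (\<integral>\<^sup>+y\<in>C. ennreal (\<bar>f x - f y\<bar> powr p) \<partial>M)"
      using powr_abs_mean_diff_le[OF p C, of "f x"]
      by (simp add: m_def ennreal_mult abs_minus_commute)
    then show "ennreal (measure M C) * (ennreal (\<bar>f x - m\<bar> powr p) * indicator B x)
       \<le> (\<integral>\<^sup>+y\<in>C. ennreal (\<bar>f x - f y\<bar> powr p) \<partial>M) * indicator B x"
      by (auto split: split_indicator)
  qed
  finally show ?thesis by (simp add: m_def mult_ac)
qed

section \<open>Geometry of John domains\<close>

text \<open>A ball is connected, so if it meets both \<open>G\<close> and the complement it contains
  a frontier point, which is then too close to \<open>x\<close>.\<close>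

lemma infdist_frontier_ball_subset:
  fixes G :: "'a::euclidean_space set"
  assumes "x \<in> G" "r \<le> infdist x (frontier G)"
  shows "ball x r \<subseteq> G"
proof (rule ccontr)
  assume no: "\<not> ball x r \<subseteq> G"
  then have "0 < r" by (metis ball_empty empty_subsetI not_le)
  then have "x \<in> ball x r \<inter> G" using assms by simp
  then have "ball x r \<inter> G \<noteq> {}" by blast
  with no have "ball x r \<inter> frontier G \<noteq> {}"
    by (intro connected_Int_frontier) auto
  then obtain y where "y \<in> frontier G" "dist x y < r" by auto
  with infdist_le[of y "frontier G" x] assms show False by simp
qed

text \<open>The chord is the sum belonging to the one-step partition in the supremum that defines
  \<open>curve_length\<close>.\<close>

lemma arc_length_param_dist_le:
  assumes g: "arc_length_param g l" and ab: "a \<in> {0..l}" "b \<in> {0..l}"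
  shows "dist (g a) (g b) \<le> \<bar>a - b\<bar>"
  using ab
proof (induction a b rule: linorder_wlog)
  case (le a b)
  define t where "t = (\<lambda>i::nat. if i = 0 then a else b)"
  have "ennreal (dist (g a) (g b)) \<le> curve_length g a b"
    unfolding curve_length_def
    by (rule SUP_upper2[where i="(1, t)"]) (use le in \<open>auto simp: t_def dist_commute\<close>)
  also have "\<dots> = ennreal (b - a)" using g le by (auto simp: arc_length_param_def)
  finally show ?case using le by simp
qed (simp add: dist_commute abs_minus_commute)

text \<open>The John curve from \<open>x\<close>, stopped at \<open>x0\<close> and reparametrised so that all points share the
  parameter interval \<open>{0<..R}\<close>.\<close>
lemma John_domain_curves:
  fixes G :: "'a::euclidean_space set"
  assumes "John_domain 1 G"
  obtains x0 R A where "x0 \<in> G" "0 < R" "1 \<le> A"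
    and "\<And>x. x \<in> G \<Longrightarrow> \<exists>h. h R = x0 \<and> (\<forall>s\<in>{0<..R}. h s \<in> G \<and> dist (h s) x \<le> s \<and>
          s \<le> A * infdist (h s) (frontier G)) \<and> (\<forall>s\<in>{0<..R}. \<forall>t\<in>{0<..R}. dist (h s) (h t) \<le> \<bar>s - t\<bar>)"
proof -
  have G: "open G" "bounded G" using assms by (simp_all add: John_domain_def)
  from assms have "\<exists>x0\<in>G. \<exists>c>0. \<forall>x\<in>G. \<exists>g l. arc_length_param g l \<and> g ` {0..l} \<subseteq> G \<and>
         g 0 = x \<and> g l = x0 \<and> l \<le> c \<and>
         (\<forall>t\<in>{0..l}. infdist (g t) (frontier G) \<ge> t powr 1 / c)"
    by (simp only: John_domain_def)
  then obtain x0 c where x0: "x0 \<in> G" "0 < c" and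
    curve: "\<And>x. x \<in> G \<Longrightarrow> \<exists>g l. arc_length_param g l \<and> g ` {0..l} \<subseteq> G \<and>
         g 0 = x \<and> g l = x0 \<and> l \<le> c \<and>
         (\<forall>t\<in>{0..l}. infdist (g t) (frontier G) \<ge> t powr 1 / c)"
    by metis
  note G = G x0
  \<comment> \<open>A nonempty bounded set is not the whole space. With an empty frontier
    \<open>infdist\<close> would be 0 by default.\<close>
  have fne: "frontier G \<noteq> {}"
    using G by (metis empty_iff frontier_eq_empty not_bounded_UNIV)
  have d0: "0 < infdist x0 (frontier G)"
  proof -
    have "x0 \<notin> frontier G" using G by (simp add: frontier_def interior_open)
    then show ?thesis using fne
      by (metis frontier_closed in_closed_iff_infdist_zero infdist_nonneg less_eq_real_def)
  qed
  \<comment> \<open>The entry \<open>c\<close> serves the parameters on the curve, the quotient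
    those beyond its end, where the point is \<open>x0\<close> and the parameter is still at most
    \<open>c\<close>.\<close>
  define A where "A = max 1 (max c (c / infdist x0 (frontier G)))"
  have A: "1 \<le> A" "c \<le> A" "c \<le> A * infdist x0 (frontier G)"
    using d0 by (auto simp: A_def pos_divide_le_eq[OF d0, symmetric])
  show ?thesis
  proof (rule that[of x0 c A])
    fix x assume x: "x \<in> G"
    from curve[OF x] obtain g l where g: "arc_length_param g l" "g ` {0..l} \<subseteq> G"
         "g 0 = x" "g l = x0" "l \<le> c" "\<And>t. t \<in> {0..l} \<Longrightarrow> infdist (g t) (frontier G) \<ge> t powr 1 / c"
      by blast
    have l: "0 \<le> l" using g by (simp add: arc_length_param_def)
    \<comment> \<open>The curve rests at \<open>x0\<close> after time \<open>l\<close>. All curves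
      can then be used on \<open>{0<..c}\<close>, and the Lipschitz bound survives since s -> min s
      l is 1-Lipschitz.\<close>
    define h where "h = (\<lambda>s. g (min s l))"
    have lip: "dist (h s) (h t) \<le> \<bar>s - t\<bar>" if "0 \<le> s" "0 \<le> t" for s t
    proof -
      have "dist (h s) (h t) \<le> \<bar>min s l - min t l\<bar>"
        unfolding h_def using that l by (intro arc_length_param_dist_le[OF g(1)]) auto
      then show ?thesis by auto
    qed
    show "\<exists>h. h c = x0 \<and> (\<forall>s\<in>{0<..c}. h s \<in> G \<and> dist (h s) x \<le> s \<and>
          s \<le> A * infdist (h s) (frontier G)) \<and> (\<forall>s\<in>{0<..c}. \<forall>t\<in>{0<..c}. dist (h s) (h t) \<le> \<bar>s - t\<bar>)"
    proof (intro exI[of _ h] conjI ballI)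
      show "h c = x0" using g by (simp add: h_def)
    next
      fix s assume s: "s \<in> {0<..c}"
      show "h s \<in> G" using s g l by (auto simp: h_def)
      have "h 0 = x" using l g by (simp add: h_def)
      then show "dist (h s) x \<le> s" using lip[of s 0] s by simp
      show "s \<le> A * infdist (h s) (frontier G)"
      proof (cases "s \<le> l")
        case True
        then have "s / c \<le> infdist (h s) (frontier G)"
          using g(6)[of s] s by (simp add: h_def)
        then have "s \<le> c * infdist (h s) (frontier G)"
          using G by (simp add: field_simps)
        also have "\<dots> \<le> A * infdist (h s) (frontier G)"
          using A by (intro mult_right_mono infdist_nonneg)
        finally show ?thesis .
      next
        case False
        then show ?thesis using g A s by (simp add: h_def)
      qed
    qed (use lip in auto)
  qed (use G A in auto)
qed

section \<open>Comparing values and ball means through the fractional density\<close>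

text \<open>The inner integral of the inequality, with \<open>q\<close> standing for n + \<delta> p.
  It is taken over \<open>lborel\<close> so that measurability in \<open>x\<close> and Tonelli are
  available for Borel functions.\<close>

definition fractional_density ::
  "real \<Rightarrow> real \<Rightarrow> real \<Rightarrow> 'a::euclidean_space set \<Rightarrow> ('a \<Rightarrow> real) \<Rightarrow> 'a \<Rightarrow> ennreal" where
  "fractional_density p q \<tau> G u x =
     (\<integral>\<^sup>+y\<in>G \<inter> ball x (\<tau> * infdist x (frontier G)).
        ennreal (\<bar>u x - u y\<bar> powr p / dist x y powr q) \<partial>lborel)"

lemma borel_measurable_infdist [measurable (raw)]:
  fixes f :: "'b \<Rightarrow> 'a::euclidean_space"
  assumes "f \<in> borel_measurable M"
  shows "(\<lambda>x. infdist (f x) S) \<in> borel_measurable M"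
  by (rule borel_measurable_continuous_on[OF _ assms]) (intro continuous_intros)

lemma borel_measurable_fractional_density [measurable]:
  fixes G :: "'a::euclidean_space set"
  assumes [measurable]: "G \<in> sets borel" "u \<in> borel_measurable borel"
  shows "fractional_density p q \<tau> G u \<in> borel_measurable borel"
proof -
  \<comment> \<open>The domain of integration moves with \<open>x\<close>; written as a condition it
    is jointly measurable in \<open>x\<close> and \<open>y\<close>.\<close>
  have "(\<lambda>x. \<integral>\<^sup>+y. (if y \<in> G \<and> dist x y < \<tau> * infdist x (frontier G)
      then ennreal (\<bar>u x - u y\<bar> powr p / dist x y powr q) else 0) \<partial>lborel) \<in> borel_measurable borel"
    by measurable
  moreover have "fractional_density p q \<tau> G u = (\<lambda>x. \<integral>\<^sup>+y. (if y \<in> G \<and> dist x y < \<tau> * infdist x (frontier G)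
      then ennreal (\<bar>u x - u y\<bar> powr p / dist x y powr q) else 0) \<partial>lborel)"
    by (auto simp: fun_eq_iff fractional_density_def intro!: nn_integral_cong split: split_indicator)
  ultimately show ?thesis by simp
qed

text \<open>On \<open>C\<close> the weight |y - w|^(-q) is at least \<rho>^(-q), and
  \<open>C\<close> lies in the domain of integration of the density at \<open>y\<close>.\<close>

lemma nn_integral_powr_diff_le_fractional_density:
  fixes G :: "'a::euclidean_space set" and p q :: real
  assumes [measurable]: "u \<in> borel_measurable borel" "C \<in> sets borel"
    and C: "C \<subseteq> G" "\<And>w. w \<in> C \<Longrightarrow> dist y w \<le> \<rho> \<and> dist y w < \<tau> * infdist y (frontier G)"
    and pq: "0 < p" "0 \<le> q"
  shows "(\<integral>\<^sup>+w\<in>C. ennreal (\<bar>u y - u w\<bar> powr p) \<partial>lborel)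
    \<le> ennreal (\<rho> powr q) * fractional_density p q \<tau> G u y"
proof -
  have le: "\<bar>u y - u w\<bar> powr p \<le> \<rho> powr q * (\<bar>u y - u w\<bar> powr p / dist y w powr q)" if "w \<in> C" for w
  \<comment> \<open>On the diagonal the numerator vanishes, so the division by zero is
    harmless.\<close>
  proof (cases "y = w")
    case False
    then have "\<bar>u y - u w\<bar> powr p * dist y w powr q \<le> \<bar>u y - u w\<bar> powr p * \<rho> powr q"
      using C(2)[OF that] pq by (intro mult_left_mono powr_mono2) auto
    then show ?thesis using False by (simp add: field_simps)
  qed (use pq in auto)
  have "(\<integral>\<^sup>+w\<in>C. ennreal (\<bar>u y - u w\<bar> powr p) \<partial>lborel)
      \<le> (\<integral>\<^sup>+w. ennreal (\<rho> powr q) * (ennreal (\<bar>u y - u w\<bar> powr p / dist y w powr q) * indicator C w) \<partial>lborel)"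
    using le by (intro nn_integral_mono) (auto simp: ennreal_mult[symmetric] intro!: ennreal_leI split: split_indicator)
  also have "\<dots> = ennreal (\<rho> powr q) * (\<integral>\<^sup>+w\<in>C. ennreal (\<bar>u y - u w\<bar> powr p / dist y w powr q) \<partial>lborel)"
    by (intro nn_integral_cmult) measurable
  also have "\<dots> \<le> ennreal (\<rho> powr q) * fractional_density p q \<tau> G u y"
    unfolding fractional_density_def using C
    by (intro mult_left_mono nn_integral_mono) (auto split: split_indicator)
  finally show ?thesis .
qed

abbreviation ball_mean :: "('a::euclidean_space \<Rightarrow> real) \<Rightarrow> 'a \<Rightarrow> real \<Rightarrow> real" where
  "ball_mean u z r \<equiv> (LINT y:ball z r|lborel. u y) / measure lborel (ball z r)"

lemma powr_abs_diff_ball_mean_le: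
  fixes G :: "'a::euclidean_space set" and p q :: real
  assumes u: "u \<in> borel_measurable borel" "set_integrable lborel G u"
    and r: "0 < r" "ball z r \<subseteq> G"
      "\<And>w. w \<in> ball z r \<Longrightarrow> dist y w \<le> \<rho> \<and> dist y w < \<tau> * infdist y (frontier G)"
    and pq: "1 \<le> p" "0 \<le> q"
  shows "ennreal (measure lborel (ball z r) * \<bar>u y - ball_mean u z r\<bar> powr p)
    \<le> ennreal (\<rho> powr q) * fractional_density p q \<tau> G u y"
proof -
  have "set_integrable lborel (ball z r) u"
    by (rule set_integrable_subset[OF u(2)]) (use r in auto)
  then have "ennreal (measure lborel (ball z r) * \<bar>ball_mean u z r - u y\<bar> powr p)
      \<le> (\<integral>\<^sup>+w\<in>ball z r. ennreal (\<bar>u w - u y\<bar> powr p) \<partial>lborel)"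
    using r by (intro powr_abs_mean_diff_le pq) (auto simp: emeasure_ball content_ball_pos)
  also have "\<dots> \<le> ennreal (\<rho> powr q) * fractional_density p q \<tau> G u y"
    using nn_integral_powr_diff_le_fractional_density[of u "ball z r" G y \<rho> \<tau> p q] u r pq
    by (simp add: abs_minus_commute)
  finally show ?thesis by (simp add: abs_minus_commute)
qed

text \<open>Jensen's inequality on both balls leaves a double integral, whose inner integral is
  bounded by the density at each \<open>y\<close> of the first ball.\<close>

lemma powr_abs_ball_mean_diff_le:
  fixes G :: "'a::euclidean_space set" and p q :: real
  assumes u: "u \<in> borel_measurable borel" "set_integrable lborel G u" and G: "G \<in> sets borel"
    and r: "0 < r" "ball z r \<subseteq> G" "0 < r'" "ball z' r' \<subseteq> G"
      "\<And>y w. y \<in> ball z r \<Longrightarrow> w \<in> ball z' r' \<Longrightarrow> dist y w \<le> \<rho> \<and> dist y w < \<tau> * infdist y (frontier G)"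
    and pq: "1 \<le> p" "0 \<le> q"
  shows "ennreal (measure lborel (ball z r) * measure lborel (ball z' r') * \<bar>ball_mean u z r - ball_mean u z' r'\<bar> powr p)
    \<le> ennreal (\<rho> powr q) * (\<integral>\<^sup>+y\<in>ball z r. fractional_density p q \<tau> G u y \<partial>lborel)"
proof -
  note [measurable] = u(1) G
  have [measurable]: "Measurable.pred borel (\<lambda>x. x \<in> ball z r)" by simp
  have "set_integrable lborel (ball z r) u" "set_integrable lborel (ball z' r') u"
    by (rule set_integrable_subset[OF u(2)]; use r in auto)+
  then have "ennreal (measure lborel (ball z r) * measure lborel (ball z' r') * \<bar>ball_mean u z r - ball_mean u z' r'\<bar> powr p)
      \<le> (\<integral>\<^sup>+y\<in>ball z r. (\<integral>\<^sup>+w\<in>ball z' r'. ennreal (\<bar>u y - u w\<bar> powr p) \<partial>lborel) \<partial>lborel)"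
    using r by (intro powr_abs_mean_diff_mean_le pq) (auto simp: emeasure_ball content_ball_pos)
  also have "\<dots> \<le> (\<integral>\<^sup>+y. ennreal (\<rho> powr q) * (fractional_density p q \<tau> G u y * indicator (ball z r) y) \<partial>lborel)"
  proof (intro nn_integral_mono)
    fix y
    show "(\<integral>\<^sup>+w\<in>ball z' r'. ennreal (\<bar>u y - u w\<bar> powr p) \<partial>lborel) * indicator (ball z r) y
        \<le> ennreal (\<rho> powr q) * (fractional_density p q \<tau> G u y * indicator (ball z r) y)"
      using nn_integral_powr_diff_le_fractional_density[of u "ball z' r'" G y \<rho> \<tau> p q] u r pq
      by (auto split: split_indicator)
  qed
  also have "\<dots> = ennreal (\<rho> powr q) * (\<integral>\<^sup>+y\<in>ball z r. fractional_density p q \<tau> G u y \<partial>lborel)"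
    by (intro nn_integral_cmult) measurable
  finally show ?thesis .
qed

section \<open>The chain of balls and the pointwise bound\<close>

lemma powr_add_le:
  fixes a b p :: real
  assumes "0 \<le> a" "0 \<le> b" "0 \<le> p"
  shows "(a + b) powr p \<le> 2 powr p * (a powr p + b powr p)"
proof -
  have "(a + b) powr p \<le> (2 * max a b) powr p"
    using assms by (intro powr_mono2) auto
  also have "\<dots> = 2 powr p * max a b powr p" using assms by (simp add: powr_mult)
  also have "\<dots> \<le> 2 powr p * (a powr p + b powr p)"
    by (intro mult_left_mono) (auto simp: max_def)
  finally show ?thesis .
qed

text \<open>After p-th roots the terms are dominated by a geometric series of ratio
  \<theta>^\<delta>, which is below 1 because \<delta> > 0. The result is linear in
  \<open>C\<close>, so an integral hidden in \<open>C\<close> can later be integrated in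
  \<open>x\<close>.\<close>

lemma powr_sum_geometric_le:
  fixes e :: "nat \<Rightarrow> real"
  assumes e: "\<And>k. k < K \<Longrightarrow> 0 \<le> e k" "\<And>k. k < K \<Longrightarrow> e k powr p \<le> C * (R * \<theta> ^ k) powr (\<delta> * p)"
    and *: "0 < p" "0 \<le> C" "0 < R" "0 < \<theta>" "\<theta> < 1" "0 < \<delta>"
  shows "(\<Sum>k<K. e k) powr p \<le> C * (R powr \<delta> / (1 - \<theta> powr \<delta>)) powr p"
proof -
  define \<mu> where "\<mu> = \<theta> powr \<delta>"
  have \<mu>: "0 < \<mu>" "\<mu> < 1" using * by (auto simp: \<mu>_def powr_less_mono2[of \<delta> \<theta> 1, simplified])
  have "e k \<le> C powr (1/p) * R powr \<delta> * \<mu> ^ k" if "k < K" for k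
  proof -
    have "e k = (e k powr p) powr (1/p)" using e(1)[OF that] * by (simp add: powr_powr)
    also have "\<dots> \<le> (C * (R * \<theta> ^ k) powr (\<delta> * p)) powr (1/p)"
      using e(2)[OF that] * by (intro powr_mono2) auto
    also have "\<dots> = C powr (1/p) * R powr \<delta> * \<mu> ^ k"
      using * by (simp add: powr_mult powr_powr \<mu>_def powr_realpow[symmetric] mult_ac)
    finally show ?thesis .
  qed
  then have "(\<Sum>k<K. e k) \<le> (\<Sum>k<K. C powr (1/p) * R powr \<delta> * \<mu> ^ k)"
    by (intro sum_mono) auto
  also have "\<dots> \<le> C powr (1/p) * (R powr \<delta> / (1 - \<mu>))"
  proof -
    have "(\<Sum>k<K. \<mu> ^ k) \<le> 1 / (1 - \<mu>)"
      using \<mu> sum_le_suminf[of "\<lambda>k. \<mu> ^ k" "{..<K}"] by (simp add: suminf_geometric summable_geometric)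
    from mult_left_mono[OF this, of "C powr (1/p) * R powr \<delta>"] show ?thesis
      by (simp add: sum_distrib_left)
  qed
  finally have "(\<Sum>k<K. e k) powr p \<le> (C powr (1/p) * (R powr \<delta> / (1 - \<mu>))) powr p"
    using e(1) * by (intro powr_mono2 sum_nonneg) auto
  also have "\<dots> = C * (R powr \<delta> / (1 - \<theta> powr \<delta>)) powr p"
    using * \<mu> by (subst powr_mult) (auto simp: powr_powr \<mu>_def)
  finally show ?thesis .
qed

text \<open>A single weight that dominates the normalised indicators of all balls in the chain of
  \<open>x\<close> up to a constant factor, and whose integral in \<open>x\<close> is bounded
  uniformly in \<open>y\<close>.\<close>

definition John_kernel :: "'a::euclidean_space set \<Rightarrow> real \<Rightarrow> 'a \<Rightarrow> 'a \<Rightarrow> real" where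
  "John_kernel G L x y = (if y \<in> G \<and> dist x y < L * infdist y (frontier G)
     then 1 / infdist y (frontier G) ^ DIM('a) else 0)"

lemma John_kernel_nonneg [simp]: "0 \<le> John_kernel G L x y"
  by (simp add: John_kernel_def infdist_nonneg)

lemma measurable_John_kernel [measurable (raw)]:
  fixes G :: "'a::euclidean_space set"
  assumes [measurable]: "G \<in> sets borel" "f \<in> borel_measurable M" "g \<in> borel_measurable M"
  shows "(\<lambda>x. John_kernel G L (f x) (g x)) \<in> borel_measurable M"
  unfolding John_kernel_def by measurable

text \<open>A count of powers of \<open>s\<close>: the two ball volumes give s^(2n) on the left; on
  the right, distances up to 3 \<epsilon> s give s^(n + \<delta> p), and trading the ball for the
  kernel costs (N s)^n. What remains is s^(\<delta> p).\<close>

lemma chain_step_le: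
  fixes G :: "'a::euclidean_space set" and p \<delta> :: real
  defines "n \<equiv> DIM('a)" and "v \<equiv> unit_ball_vol DIM('a)"
  assumes u: "u \<in> borel_measurable borel" "set_integrable lborel G u" and G: "G \<in> sets borel"
    and par: "0 < s" "0 < \<epsilon>" "0 < \<theta>" "0 < \<delta>" "1 \<le> p" "0 \<le> X"
    and sub: "ball z (\<epsilon> * s) \<subseteq> G" "ball z' (\<epsilon> * (\<theta> * s)) \<subseteq> G"
    and near: "\<And>y w. y \<in> ball z (\<epsilon> * s) \<Longrightarrow> w \<in> ball z' (\<epsilon> * (\<theta> * s)) \<Longrightarrow>
      dist y w \<le> 3 * \<epsilon> * s \<and> dist y w < \<tau> * infdist y (frontier G)"
    and ker: "\<And>y. y \<in> ball z (\<epsilon> * s) \<Longrightarrow> 0 < infdist y (frontier G) \<and> infdist y (frontier G) \<le> N * s \<and>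
       dist x y < L * infdist y (frontier G)"
    and X: "(\<integral>\<^sup>+y. ennreal (John_kernel G L x y) * fractional_density p (n + \<delta> * p) \<tau> G u y \<partial>lborel) \<le> ennreal X"
  shows "\<bar>ball_mean u z (\<epsilon> * s) - ball_mean u z' (\<epsilon> * (\<theta> * s))\<bar> powr p
    \<le> ((3 * \<epsilon>) powr (n + \<delta> * p) * N ^ n / (v\<^sup>2 * \<epsilon> ^ n * \<epsilon> ^ n * \<theta> ^ n)) * X * s powr (\<delta> * p)"
proof -
  note [measurable] = u(1) G
  let ?F = "fractional_density p (n + \<delta> * p) \<tau> G u"
  let ?e = "\<bar>ball_mean u z (\<epsilon> * s) - ball_mean u z' (\<epsilon> * (\<theta> * s))\<bar> powr p"
  have v: "0 < v" by (simp add: v_def)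
  have "0 < \<epsilon> * s" using par by simp
  then have "z \<in> ball z (\<epsilon> * s)" by simp
  \<comment> \<open>The sign of \<open>N\<close> is read off at the centre of the ball.\<close>
  from ker[OF this] have "0 < N * s" by linarith
  then have N: "0 < N" using par by (simp add: zero_less_mult_iff)
  have "(\<integral>\<^sup>+y\<in>ball z (\<epsilon> * s). ?F y \<partial>lborel)
      \<le> (\<integral>\<^sup>+y. ennreal ((N * s) ^ n) * (ennreal (John_kernel G L x y) * ?F y) \<partial>lborel)"
  proof (intro nn_integral_mono)
    fix y
    show "?F y * indicator (ball z (\<epsilon> * s)) y \<le> ennreal ((N * s) ^ n) * (ennreal (John_kernel G L x y) * ?F y)"
    proof (cases "y \<in> ball z (\<epsilon> * s)")
      case True
      \<comment> \<open>Here the upper bound d(y) \<le> N s on the distance to the boundary is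
        used.\<close>
      have "1 \<le> (N * s) ^ n * John_kernel G L x y"
        using ker[OF True] subsetD[OF sub(1) True]
        by (auto simp: John_kernel_def n_def intro!: power_mono)
      then have "1 \<le> ennreal ((N * s) ^ n) * ennreal (John_kernel G L x y)"
        using N par by (simp add: ennreal_mult'[symmetric] flip: ennreal_1)
      from mult_right_mono[OF this, of "?F y"] show ?thesis using True by (simp add: mult.assoc)
    qed simp
  qed
  also have "\<dots> = ennreal ((N * s) ^ n) * (\<integral>\<^sup>+y. ennreal (John_kernel G L x y) * ?F y \<partial>lborel)"
    by (intro nn_integral_cmult) measurable
  also have "\<dots> \<le> ennreal ((N * s) ^ n) * ennreal X"
    by (intro mult_left_mono X) auto
  finally have F: "(\<integral>\<^sup>+y\<in>ball z (\<epsilon> * s). ?F y \<partial>lborel) \<le> ennreal ((N * s) ^ n) * ennreal X" .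
  have "ennreal (measure lborel (ball z (\<epsilon> * s)) * measure lborel (ball z' (\<epsilon> * (\<theta> * s))) * ?e)
      \<le> ennreal ((3 * \<epsilon> * s) powr (n + \<delta> * p)) * (\<integral>\<^sup>+y\<in>ball z (\<epsilon> * s). ?F y \<partial>lborel)"
    using par by (intro powr_abs_ball_mean_diff_le[OF u G _ sub(1) _ sub(2) near]) auto
  also have "\<dots> \<le> ennreal ((3 * \<epsilon> * s) powr (n + \<delta> * p)) * (ennreal ((N * s) ^ n) * ennreal X)"
    by (intro mult_left_mono F) auto
  also have "\<dots> = ennreal ((3 * \<epsilon> * s) powr (n + \<delta> * p) * ((N * s) ^ n * X))"
    using N par by (simp add: ennreal_mult)
  finally have "measure lborel (ball z (\<epsilon> * s)) * measure lborel (ball z' (\<epsilon> * (\<theta> * s))) * ?e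
      \<le> (3 * \<epsilon> * s) powr (n + \<delta> * p) * ((N * s) ^ n * X)"
    using N par by (subst (asm) ennreal_le_iff) auto
  also have "measure lborel (ball z (\<epsilon> * s)) * measure lborel (ball z' (\<epsilon> * (\<theta> * s)))
      = (v\<^sup>2 * \<epsilon> ^ n * \<epsilon> ^ n * \<theta> ^ n) * (s ^ n * s ^ n)"
    using par by (simp add: content_ball v_def n_def power_mult_distrib power2_eq_square)
  also have "(3 * \<epsilon> * s) powr (n + \<delta> * p) = (3 * \<epsilon>) powr (n + \<delta> * p) * s ^ n * s powr (\<delta> * p)"
    using par by (simp add: powr_mult powr_add powr_realpow)
  finally have "(v\<^sup>2 * \<epsilon> ^ n * \<epsilon> ^ n * \<theta> ^ n * ?e) * (s ^ n * s ^ n)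
      \<le> ((3 * \<epsilon>) powr (n + \<delta> * p) * s powr (\<delta> * p) * N ^ n * X) * (s ^ n * s ^ n)"
    by (simp add: power_mult_distrib mult_ac)
  then have "v\<^sup>2 * \<epsilon> ^ n * \<epsilon> ^ n * \<theta> ^ n * ?e
      \<le> (3 * \<epsilon>) powr (n + \<delta> * p) * s powr (\<delta> * p) * N ^ n * X"
    using par by (simp add: mult_le_cancel_right)
  moreover have "0 < v\<^sup>2 * \<epsilon> ^ n * \<epsilon> ^ n * \<theta> ^ n" using v par by simp
  ultimately show ?thesis by (simp add: pos_le_divide_eq mult_ac)
qed

text \<open>The last ball lies within the range of the density at \<open>x\<close> itself, so no
  limit of ball means is required. The volume cancels s^n, and the remaining s^(\<delta> p) is at
  most R^(\<delta> p).\<close>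

lemma chain_end_le:
  fixes G :: "'a::euclidean_space set" and p \<delta> :: real
  defines "n \<equiv> DIM('a)" and "v \<equiv> unit_ball_vol DIM('a)"
  assumes u: "u \<in> borel_measurable borel" "set_integrable lborel G u"
    and par: "0 < s" "s \<le> R" "0 < \<epsilon>" "0 < \<delta>" "1 \<le> p"
    and sub: "ball z (\<epsilon> * s) \<subseteq> G"
    and near: "\<And>w. w \<in> ball z (\<epsilon> * s) \<Longrightarrow> dist x w \<le> 2 * s \<and> dist x w < \<tau> * infdist x (frontier G)"
  shows "ennreal (\<bar>u x - ball_mean u z (\<epsilon> * s)\<bar> powr p)
    \<le> ennreal (2 powr (n + \<delta> * p) * R powr (\<delta> * p) / (v * \<epsilon> ^ n)) * fractional_density p (n + \<delta> * p) \<tau> G u x"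
proof -
  let ?F = "fractional_density p (n + \<delta> * p) \<tau> G u x"
  have v: "0 < v" by (simp add: v_def)
  have m: "measure lborel (ball z (\<epsilon> * s)) = v * \<epsilon> ^ n * s ^ n"
    using par by (simp add: content_ball v_def n_def power_mult_distrib)
  have pos: "0 < v * \<epsilon> ^ n * s ^ n" using v par by simp
  have "ennreal (\<bar>u x - ball_mean u z (\<epsilon> * s)\<bar> powr p)
      = ennreal (1 / (v * \<epsilon> ^ n * s ^ n)) * ennreal (measure lborel (ball z (\<epsilon> * s)) * \<bar>u x - ball_mean u z (\<epsilon> * s)\<bar> powr p)"
    using v par unfolding m by (simp add: ennreal_mult'[symmetric])
  also have "\<dots> \<le> ennreal (1 / (v * \<epsilon> ^ n * s ^ n)) * (ennreal ((2 * s) powr (n + \<delta> * p)) * ?F)"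
    using par by (intro mult_left_mono powr_abs_diff_ball_mean_le[OF u _ sub near]) auto
  also have "\<dots> = ennreal ((2 * s) powr (n + \<delta> * p) / (v * \<epsilon> ^ n * s ^ n)) * ?F"
    using pos by (simp add: mult.assoc[symmetric] ennreal_mult'[symmetric])
  also have "(2 * s) powr (n + \<delta> * p) / (v * \<epsilon> ^ n * s ^ n) = 2 powr (n + \<delta> * p) * s powr (\<delta> * p) / (v * \<epsilon> ^ n)"
    using par v by (simp add: powr_mult powr_add powr_realpow field_simps)
  also have "ennreal (2 powr (n + \<delta> * p) * s powr (\<delta> * p) / (v * \<epsilon> ^ n)) * ?F
      \<le> ennreal (2 powr (n + \<delta> * p) * R powr (\<delta> * p) / (v * \<epsilon> ^ n)) * ?F"
    using par v by (intro mult_right_mono ennreal_leI divide_right_mono mult_left_mono powr_mono2) auto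
  finally show ?thesis .
qed

text \<open>All constants and the reference ball are fixed before \<open>u\<close> and
  \<open>x\<close>; only the chain depends on \<open>x\<close>.\<close>

lemma John_domain_pointwise_bound:
  fixes G :: "'a::euclidean_space set" and p \<delta> \<tau> :: real
  assumes John: "John_domain 1 G" and p: "1 \<le> p" and \<delta>: "0 < \<delta>" and \<tau>: "0 < \<tau>" "\<tau> < 1"
  obtains x0 r C L where "0 < r" "ball x0 r \<subseteq> G" "0 \<le> C" "0 \<le> L"
    "\<And>u x. u \<in> borel_measurable borel \<Longrightarrow> set_integrable lborel G u \<Longrightarrow> x \<in> G \<Longrightarrow>
      ennreal (\<bar>u x - ball_mean u x0 r\<bar> powr p)
      \<le> ennreal C * (fractional_density p (DIM('a) + \<delta> * p) \<tau> G u x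
        + (\<integral>\<^sup>+y. ennreal (John_kernel G L x y) * fractional_density p (DIM('a) + \<delta> * p) \<tau> G u y \<partial>lborel))"
proof -
  define n where "n = DIM('a)"
  define v where "v = unit_ball_vol n"
  have v: "0 < v" by (simp add: v_def)
  have G: "G \<in> sets borel" "open G" using John by (auto simp: John_domain_def)
  obtain x0 R A where x0: "x0 \<in> G" and RA: "0 < R" "1 \<le> A"
    and curves: "\<And>x. x \<in> G \<Longrightarrow> \<exists>h. h R = x0 \<and> (\<forall>s\<in>{0<..R}. h s \<in> G \<and> dist (h s) x \<le> s \<and>
          s \<le> A * infdist (h s) (frontier G)) \<and> (\<forall>s\<in>{0<..R}. \<forall>t\<in>{0<..R}. dist (h s) (h t) \<le> \<bar>s - t\<bar>)"
    using John_domain_curves[OF John] by metis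
  \<comment> \<open>The choice gives \<open>A * \<epsilon> = \<tau> / 4\<close> and \<epsilon> <
    1/4. With \<theta> = 1 - \<epsilon>, consecutive centres are at most \<epsilon> s apart, so
    points of consecutive balls are within 3 \<epsilon> s. \<open>N\<close> comes from d(y) \<le>
    d(x) + |x - y| \<le> (2/\<tau>) s + 2 s, and \<open>L\<close> from |x - y| < 2 s together with
    (3/4) s \<le> A d(y).\<close>
  define \<epsilon> where "\<epsilon> = \<tau> / (4 * A)"
  define \<theta> where "\<theta> = 1 - \<epsilon>"
  define N where "N = 2 / \<tau> + 2"
  define L where "L = 3 * A"
  define C1 where "C1 = (3 * \<epsilon>) powr (n + \<delta> * p) * N ^ n / (v\<^sup>2 * \<epsilon> ^ n * \<epsilon> ^ n * \<theta> ^ n)"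
  define C2 where "C2 = 2 powr (n + \<delta> * p) * R powr (\<delta> * p) / (v * \<epsilon> ^ n)"
  define C3 where "C3 = C1 * (R powr \<delta> / (1 - \<theta> powr \<delta>)) powr p"
  define C where "C = 2 powr p * max C2 C3"
  have A\<epsilon>: "A * \<epsilon> = \<tau> / 4" using RA by (simp add: \<epsilon>_def)
  have \<epsilon>0: "0 < \<epsilon>" using RA \<tau> by (simp add: \<epsilon>_def)
  have "1 * \<epsilon> \<le> A * \<epsilon>" using \<epsilon>0 RA by (intro mult_right_mono) auto
  then have \<epsilon>1: "\<epsilon> < 1 / 4" using A\<epsilon> \<tau> by simp
  have \<theta>: "0 < \<theta>" "\<theta> < 1" using \<epsilon>0 \<epsilon>1 by (auto simp: \<theta>_def)
  have N: "0 < N" using \<tau> by (auto simp: N_def intro!: add_pos_pos)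
  have C12: "0 \<le> C1" "0 < C2" using v \<epsilon>0 \<theta> N RA by (auto simp: C1_def C2_def)
  then have C0: "0 \<le> C" by (simp add: C_def)
  show ?thesis
  proof (rule that[of "\<epsilon> * R" x0 C L])
    show "0 < \<epsilon> * R" "0 \<le> L" using RA \<epsilon>0 by (auto simp: L_def)
    have "infdist x0 (frontier G) \<ge> \<epsilon> * R"
    proof -
      obtain h where "h R = x0" "R \<le> A * infdist (h R) (frontier G)"
        using curves[OF x0] RA by auto
      then have "\<epsilon> * R \<le> \<epsilon> * (A * infdist x0 (frontier G))"
        using \<epsilon>0 by (intro mult_left_mono) auto
      also have "\<dots> = \<tau> / 4 * infdist x0 (frontier G)" using A\<epsilon> by (simp add: mult.assoc[symmetric] mult.commute)
      also have "\<dots> \<le> 1 * infdist x0 (frontier G)"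
        using \<tau> by (intro mult_right_mono infdist_nonneg) auto
      finally show ?thesis by simp
    qed
    then show "ball x0 (\<epsilon> * R) \<subseteq> G" by (intro infdist_frontier_ball_subset x0)
    show "0 \<le> C" by (rule C0)
  next
    fix u :: "'a \<Rightarrow> real" and x
    assume u: "u \<in> borel_measurable borel" "set_integrable lborel G u" and x: "x \<in> G"
    define F where "F = fractional_density p (n + \<delta> * p) \<tau> G u"
    define d where "d = (\<lambda>y. infdist y (frontier G))"
    obtain h where h: "h R = x0" "\<And>s. s \<in> {0<..R} \<Longrightarrow> h s \<in> G \<and> dist (h s) x \<le> s \<and> s \<le> A * d (h s)"
      "\<And>s t. s \<in> {0<..R} \<Longrightarrow> t \<in> {0<..R} \<Longrightarrow> dist (h s) (h t) \<le> \<bar>s - t\<bar>"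
      using curves[OF x] by (auto simp: d_def)
    have dlip: "d y \<le> d w + dist y w" for y w
      unfolding d_def by (rule infdist_triangle)
    \<comment> \<open>Moving by \<epsilon> s costs at most A \<epsilon> s = \<tau> s / 4 in A d. The
      second bound places the next ball of the chain within reach of the density at
      \<open>w\<close>.\<close>
    have dlow: "3 / 4 * s \<le> A * d w \<and> 3 * \<epsilon> * s \<le> \<tau> * d w"
      if "s \<in> {0<..R}" "w \<in> ball (h s) (\<epsilon> * s)" for s w
    proof -
      have "d (h s) - \<epsilon> * s \<le> d w" using dlip[of "h s" w] that by simp
      then have "A * (d (h s) - \<epsilon> * s) \<le> A * d w" using RA by (intro mult_left_mono) auto
      then have "s - A * \<epsilon> * s \<le> A * d w" using h(2)[OF that(1)] by (simp add: algebra_simps)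
      moreover have "\<tau> * s \<le> 1 * s" using \<tau> that by (intro mult_right_mono) auto
      ultimately have 2: "3 / 4 * s \<le> A * d w" by (simp add: A\<epsilon>)
      have "3 * \<epsilon> * s = 4 * \<epsilon> * (3 / 4 * s)" by simp
      also have "\<dots> \<le> 4 * \<epsilon> * (A * d w)" using 2 \<epsilon>0 by (intro mult_left_mono) auto
      also have "\<dots> = \<tau> * d w" using A\<epsilon> by (simp add: mult_ac)
      finally show ?thesis using 2 by blast
    qed
    have sub: "ball (h s) (\<epsilon> * s) \<subseteq> G" if s: "s \<in> {0<..R}" for s
    proof (rule infdist_frontier_ball_subset)
      show "h s \<in> G" using h s by blast
      have "h s \<in> ball (h s) (\<epsilon> * s)" using s \<epsilon>0 by simp
      from dlow[OF s this] have "3 * \<epsilon> * s \<le> \<tau> * d (h s)" by blast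
      also have "\<dots> \<le> 1 * d (h s)"
        using \<tau> by (intro mult_right_mono) (auto simp: d_def infdist_nonneg)
      finally show "\<epsilon> * s \<le> infdist (h s) (frontier G)"
        using mult_pos_pos[of \<epsilon> s] s \<epsilon>0 unfolding d_def greaterThanAtMost_iff by linarith
    qed
    define X where "X = (\<integral>\<^sup>+y. ennreal (John_kernel G L x y) * F y \<partial>lborel)"
    have "ennreal (\<bar>u x - ball_mean u x0 (\<epsilon> * R)\<bar> powr p) \<le> ennreal C * (F x + X)"
    proof (cases "X = \<infinity>")
      case True
      \<comment> \<open>\<open>C2\<close> is strictly positive, which makes the right-hand side
        infinite rather than \<open>0 * \<infinity>\<close>.\<close>
      have "0 < C" using C12 by (simp add: C_def max_def)
      then show ?thesis using True by (simp add: ennreal_mult_top)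
    next
      case False
      then obtain X' where X': "X = ennreal X'" "0 \<le> X'" by (cases X) auto
      define s where "s = (\<lambda>k. R * \<theta> ^ k)"
      have s: "s k \<in> {0<..R}" for k
        using RA \<theta> by (auto simp: s_def power_le_one mult_le_cancel_left2)
      have sSuc: "s (Suc k) = \<theta> * s k" for k by (simp add: s_def)
      have dx: "0 < d x"
      proof -
        have "x \<notin> frontier G" using G x by (simp add: frontier_def interior_open)
        moreover have "frontier G \<noteq> {}"
          using John by (metis John_domain_def frontier_eq_empty not_bounded_UNIV)
        ultimately show ?thesis unfolding d_def
          by (metis frontier_closed in_closed_iff_infdist_zero infdist_nonneg less_eq_real_def)
      qed
      have "s \<longlonglongrightarrow> 0"
        unfolding s_def using \<theta> by (intro tendsto_mult_right_zero LIMSEQ_power_zero) auto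
      moreover have "0 < \<tau> / 2 * d x" using \<tau> dx by simp
      ultimately have "\<exists>k. s k \<le> \<tau> / 2 * d x"
        by (metis (no_types, lifting) order_tendstoD(2) eventually_sequentially less_imp_le order_refl)
      \<comment> \<open>At \<open>K\<close> the ball lies within 2 s \<le> \<tau> d(x) of
        \<open>x\<close>, as the comparison with u(x) demands. Minimality gives d(x) < (2/\<tau>) s
        at all earlier steps, which yields the bound by \<open>N\<close>.\<close>
      define K where "K = (LEAST k. s k \<le> \<tau> / 2 * d x)"
      have K: "s K \<le> \<tau> / 2 * d x"
        unfolding K_def by (rule LeastI_ex) fact
      have K': "\<tau> / 2 * d x < s k" if "k < K" for k
        using not_less_Least[of k "\<lambda>k. s k \<le> \<tau> / 2 * d x"] that by (simp add: K_def)
      define m where "m = (\<lambda>k. ball_mean u (h (s k)) (\<epsilon> * s k))"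
      have near_x: "dist x w < 2 * s k" if "w \<in> ball (h (s k)) (\<epsilon> * s k)" for w k
      proof -
        have "dist x w < s k + \<epsilon> * s k"
          using that h(2)[OF s[of k]] dist_triangle[of x w "h (s k)"] by (simp add: dist_commute)
        also have "\<epsilon> * s k \<le> 1 * s k" using s[of k] \<epsilon>1 by (intro mult_right_mono) auto
        finally show ?thesis by simp
      qed
      have step: "\<bar>m k - m (Suc k)\<bar> powr p \<le> C1 * X' * (R * \<theta> ^ k) powr (\<delta> * p)" if "k < K" for k
        unfolding m_def sSuc C1_def n_def v_def s_def[symmetric, THEN fun_cong]
      proof (rule chain_step_le[where x=x and L=L and \<tau>=\<tau> and G=G])
        show "(\<integral>\<^sup>+y. ennreal (John_kernel G L x y) * fractional_density p (DIM('a) + \<delta> * p) \<tau> G u y \<partial>lborel) \<le> ennreal X'"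
          using X' by (simp add: X_def F_def n_def)
        show "ball (h (s k)) (\<epsilon> * s k) \<subseteq> G" using s by (rule sub)
        show "ball (h (\<theta> * s k)) (\<epsilon> * (\<theta> * s k)) \<subseteq> G" using sub[OF s[of "Suc k"]] by (simp add: sSuc)
      next
        fix y w assume y: "y \<in> ball (h (s k)) (\<epsilon> * s k)" and w: "w \<in> ball (h (\<theta> * s k)) (\<epsilon> * (\<theta> * s k))"
        have "dist (h (s k)) (h (\<theta> * s k)) \<le> \<bar>s k - \<theta> * s k\<bar>"
          using h(3)[OF s[of k] s[of "Suc k"]] by (simp add: sSuc)
        also have "\<dots> = \<epsilon> * s k" using s[of k] \<epsilon>0 by (simp add: \<theta>_def algebra_simps)
        finally have "dist (h (s k)) (h (\<theta> * s k)) \<le> \<epsilon> * s k" .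
        moreover have "\<epsilon> * (\<theta> * s k) \<le> \<epsilon> * (1 * s k)"
          using s[of k] \<theta> \<epsilon>0 by (intro mult_left_mono mult_right_mono) auto
        moreover have "dist y w \<le> dist y (h (s k)) + (dist (h (s k)) (h (\<theta> * s k)) + dist (h (\<theta> * s k)) w)"
          by (meson add_left_mono dist_triangle order_trans)
        ultimately have "dist y w < 3 * \<epsilon> * s k" using y w by (simp add: dist_commute)
        then show "dist y w \<le> 3 * \<epsilon> * s k \<and> dist y w < \<tau> * infdist y (frontier G)"
          using dlow[OF s y] by (simp add: d_def)
      next
        fix y assume y: "y \<in> ball (h (s k)) (\<epsilon> * s k)"
        have Ad: "3 / 4 * s k \<le> A * d y" using dlow[OF s y] by simp
        then have "0 < A * d y" using s[of k] by auto
        then have "0 < d y" using RA by (simp add: zero_less_mult_iff)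
        moreover have "d y \<le> N * s k"
        proof -
          have "d x \<le> 2 / \<tau> * s k" using K'[OF that] \<tau> by (simp add: field_simps)
          then show ?thesis
            using dlip[of y x] near_x[OF y] by (simp add: N_def dist_commute distrib_right)
        qed
        moreover have "dist x y < L * d y" using near_x[OF y] Ad s[of k] by (simp add: L_def)
        ultimately show "0 < infdist y (frontier G) \<and> infdist y (frontier G) \<le> N * s k \<and>
            dist x y < L * infdist y (frontier G)"
          by (simp add: d_def)
      qed (use u G s[of k] \<epsilon>0 \<theta> \<delta> p X' in auto)
      have "\<bar>m K - m 0\<bar> \<le> (\<Sum>k<K. \<bar>m k - m (Suc k)\<bar>)"
      proof -
        have "m K - m 0 = (\<Sum>k<K. m (Suc k) - m k)" by (simp add: sum_lessThan_telescope)
        then show ?thesis using sum_abs[of "\<lambda>k. m (Suc k) - m k" "{..<K}"] by (simp add: abs_minus_commute)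
      qed
      then have "\<bar>m K - m 0\<bar> powr p \<le> (\<Sum>k<K. \<bar>m k - m (Suc k)\<bar>) powr p"
        using p by (intro powr_mono2) auto
      also have "\<dots> \<le> C1 * X' * (R powr \<delta> / (1 - \<theta> powr \<delta>)) powr p"
        using p C12 X' RA \<theta> \<delta> by (intro powr_sum_geometric_le step) auto
      also have "\<dots> = C3 * X'" by (simp add: C3_def)
      finally have chain: "\<bar>m K - m 0\<bar> powr p \<le> C3 * X'" .
      have last: "ennreal (\<bar>u x - m K\<bar> powr p) \<le> ennreal C2 * F x"
        unfolding m_def C2_def F_def n_def v_def
      proof (rule chain_end_le)
        fix w assume w: "w \<in> ball (h (s K)) (\<epsilon> * s K)"
        have "2 * s K \<le> \<tau> * d x" using K by simp
        then show "dist x w \<le> 2 * s K \<and> dist x w < \<tau> * infdist x (frontier G)"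
          using near_x[OF w] by (simp add: d_def)
      qed (use u s[of K] \<epsilon>0 \<delta> p sub[OF s] in auto)
      have C3: "0 \<le> C3" using C12 by (simp add: C3_def)
      \<comment> \<open>The mean over the last ball separates the direct comparison with u(x) from
        the telescoped chain.\<close>
      have "\<bar>u x - m 0\<bar> powr p \<le> (\<bar>u x - m K\<bar> + \<bar>m K - m 0\<bar>) powr p"
        using p by (intro powr_mono2) auto
      also have "\<dots> \<le> 2 powr p * (\<bar>u x - m K\<bar> powr p + \<bar>m K - m 0\<bar> powr p)"
        using p by (intro powr_add_le) auto
      also have "\<dots> \<le> 2 powr p * (\<bar>u x - m K\<bar> powr p + C3 * X')"
        using chain by (intro mult_left_mono add_left_mono) auto
      finally have "ennreal (\<bar>u x - m 0\<bar> powr p) \<le> ennreal (2 powr p) * (ennreal (\<bar>u x - m K\<bar> powr p) + ennreal C3 * X)"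
        using C3 X' by (simp add: ennreal_mult[symmetric] ennreal_plus[symmetric] ennreal_leI del: ennreal_plus)
      also have "\<dots> \<le> ennreal (2 powr p) * (ennreal (max C2 C3) * F x + ennreal (max C2 C3) * X)"
      proof (intro mult_left_mono add_mono)
        show "ennreal (\<bar>u x - m K\<bar> powr p) \<le> ennreal (max C2 C3) * F x"
          using last by (rule order_trans) (intro mult_right_mono ennreal_leI; simp)
        show "ennreal C3 * X \<le> ennreal (max C2 C3) * X" by (intro mult_right_mono ennreal_leI) auto
      qed auto
      also have "\<dots> = ennreal C * (F x + X)"
        using C12 by (simp add: C_def ennreal_mult distrib_left mult.assoc)
      \<comment> \<open>As \<open>s 0 = R\<close> and \<open>h R = x0\<close>, the chain starts at
        the same ball for every \<open>x\<close>.\<close>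
      finally show ?thesis by (simp add: m_def s_def h(1))
    qed
    then show "ennreal (\<bar>u x - ball_mean u x0 (\<epsilon> * R)\<bar> powr p)
      \<le> ennreal C * (fractional_density p (DIM('a) + \<delta> * p) \<tau> G u x
        + (\<integral>\<^sup>+y. ennreal (John_kernel G L x y) * fractional_density p (DIM('a) + \<delta> * p) \<tau> G u y \<partial>lborel))"
      by (simp add: X_def F_def n_def)
  qed
qed

section \<open>Integration over the domain\<close>

text \<open>By Tonelli the kernel is integrated in \<open>x\<close> first: for fixed
  \<open>y\<close> it is at most d(y)^(-n) on a ball of radius L d(y), with integral at most v L^n
  for the unit ball volume v.\<close>

lemma nn_integral_John_kernel_le:
  fixes G :: "'a::euclidean_space set"
  assumes [measurable]: "G \<in> sets borel" "F \<in> borel_measurable borel"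
    and L: "0 \<le> L" and F: "\<And>y. y \<notin> G \<Longrightarrow> F y = 0"
  shows "(\<integral>\<^sup>+x. (\<integral>\<^sup>+y. ennreal (John_kernel G L x y) * F y \<partial>lborel) \<partial>lborel)
    \<le> ennreal (unit_ball_vol DIM('a) * L ^ DIM('a)) * (\<integral>\<^sup>+y. F y \<partial>lborel)"
proof -
  have "(\<integral>\<^sup>+x. (\<integral>\<^sup>+y. ennreal (John_kernel G L x y) * F y \<partial>lborel) \<partial>lborel)
      = (\<integral>\<^sup>+y. (\<integral>\<^sup>+x. ennreal (John_kernel G L x y) * F y \<partial>lborel) \<partial>lborel)"
    by (rule lborel_pair.Fubini'[symmetric]) measurable
  also have "\<dots> \<le> (\<integral>\<^sup>+y. ennreal (unit_ball_vol DIM('a) * L ^ DIM('a)) * F y \<partial>lborel)"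
  proof (intro nn_integral_mono)
    fix y :: 'a
    define d where "d = infdist y (frontier G)"
    have d: "0 \<le> d" by (simp add: d_def infdist_nonneg)
    have "(\<integral>\<^sup>+x. ennreal (John_kernel G L x y) * F y \<partial>lborel)
        = (\<integral>\<^sup>+x. ennreal (John_kernel G L x y) \<partial>lborel) * F y"
      by (intro nn_integral_multc) measurable
    also have "(\<integral>\<^sup>+x. ennreal (John_kernel G L x y) \<partial>lborel)
        \<le> (\<integral>\<^sup>+x. ennreal (1 / d ^ DIM('a)) * indicator (ball y (L * d)) x \<partial>lborel)"
      by (intro nn_integral_mono) (auto simp: John_kernel_def d_def dist_commute split: split_indicator)
    also have "\<dots> = ennreal (1 / d ^ DIM('a)) * ennreal (unit_ball_vol DIM('a) * (L * d) ^ DIM('a))"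
      using L d by (simp add: nn_integral_cmult_indicator emeasure_ball)
    \<comment> \<open>For d > 0 the powers of d cancel; for d = 0 the left-hand side is 0.\<close>
    also have "\<dots> \<le> ennreal (unit_ball_vol DIM('a) * L ^ DIM('a))"
      using L d by (auto simp: ennreal_mult'[symmetric] power_mult_distrib intro!: ennreal_leI)
    finally show "(\<integral>\<^sup>+x. ennreal (John_kernel G L x y) * F y \<partial>lborel)
        \<le> ennreal (unit_ball_vol DIM('a) * L ^ DIM('a)) * F y"
      by (simp add: mult_right_mono)
  qed
  also have "\<dots> = ennreal (unit_ball_vol DIM('a) * L ^ DIM('a)) * (\<integral>\<^sup>+y. F y \<partial>lborel)"
    by (intro nn_integral_cmult) measurable
  finally show ?thesis .
qed

text \<open>Up to a constant the mean approximates as well as any number \<open>a\<close>: |u - m|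
  \<le> |u - a| + |m - a|, and Jensen's inequality bounds the contribution of |m - a| by the
  integral of |u - a|^p.\<close>

lemma nn_integral_powr_diff_mean_le:
  fixes u :: "'a \<Rightarrow> real"
  assumes p: "1 \<le> p" and G: "G \<in> sets M" "emeasure M G \<noteq> \<infinity>" "measure M G > 0"
    and u: "set_integrable M G u" "u \<in> borel_measurable M"
  shows "(\<integral>\<^sup>+x\<in>G. ennreal (\<bar>u x - (LINT y:G|M. u y) / measure M G\<bar> powr p) \<partial>M)
    \<le> ennreal (2 * 2 powr p) * (\<integral>\<^sup>+x\<in>G. ennreal (\<bar>u x - a\<bar> powr p) \<partial>M)"
proof -
  note [measurable] = G(1) u(2)
  define m where "m = (LINT y:G|M. u y) / measure M G"
  let ?I = "\<integral>\<^sup>+x\<in>G. ennreal (\<bar>u x - a\<bar> powr p) \<partial>M"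
  have "(\<integral>\<^sup>+x\<in>G. ennreal (\<bar>u x - m\<bar> powr p) \<partial>M)
      \<le> (\<integral>\<^sup>+x. ennreal (2 powr p) * (ennreal (\<bar>u x - a\<bar> powr p) * indicator G x
          + ennreal (\<bar>m - a\<bar> powr p) * indicator G x) \<partial>M)"
  proof (intro nn_integral_mono)
    fix x
    have "\<bar>u x - m\<bar> powr p \<le> (\<bar>u x - a\<bar> + \<bar>m - a\<bar>) powr p"
      using p by (intro powr_mono2) auto
    also have "\<dots> \<le> 2 powr p * (\<bar>u x - a\<bar> powr p + \<bar>m - a\<bar> powr p)"
      using p by (intro powr_add_le) auto
    finally show "ennreal (\<bar>u x - m\<bar> powr p) * indicator G x
        \<le> ennreal (2 powr p) * (ennreal (\<bar>u x - a\<bar> powr p) * indicator G x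
          + ennreal (\<bar>m - a\<bar> powr p) * indicator G x)"
      by (auto simp: ennreal_mult[symmetric] ennreal_plus[symmetric] simp del: ennreal_plus
          intro!: ennreal_leI split: split_indicator)
  qed
  also have "\<dots> = ennreal (2 powr p) * (?I + ennreal (\<bar>m - a\<bar> powr p) * emeasure M G)"
  proof -
    have "(\<integral>\<^sup>+x. ennreal (\<bar>u x - a\<bar> powr p) * indicator G x + ennreal (\<bar>m - a\<bar> powr p) * indicator G x \<partial>M)
        = ?I + (\<integral>\<^sup>+x. ennreal (\<bar>m - a\<bar> powr p) * indicator G x \<partial>M)"
      by (intro nn_integral_add) measurable
    also have "(\<integral>\<^sup>+x. ennreal (\<bar>m - a\<bar> powr p) * indicator G x \<partial>M) = ennreal (\<bar>m - a\<bar> powr p) * emeasure M G"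
      using G by (intro nn_integral_cmult_indicator)
    finally show ?thesis by (subst nn_integral_cmult) simp_all
  qed
  also have "\<dots> \<le> ennreal (2 powr p) * (?I + ?I)"
  proof (intro mult_left_mono add_left_mono)
    have "ennreal (\<bar>m - a\<bar> powr p) * emeasure M G = ennreal (measure M G * \<bar>m - a\<bar> powr p)"
      using G by (simp add: emeasure_eq_ennreal_measure ennreal_mult mult.commute)
    also have "\<dots> \<le> ?I"
      unfolding m_def by (rule powr_abs_mean_diff_le[OF p G u(1)])
    finally show "ennreal (\<bar>m - a\<bar> powr p) * emeasure M G \<le> ?I" .
  qed simp
  also have "\<dots> = ennreal (2 * 2 powr p) * ?I"
    by (simp add: ennreal_mult mult_2[symmetric] mult_ac)
  finally show ?thesis by (simp only: m_def)
qed

text \<open>The pointwise bound is integrated over \<open>G\<close>, the kernel term is absorbed by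
  Tonelli, and the mean over the reference ball is replaced by the mean over
  \<open>G\<close>.\<close>

lemma fractional_Poincare_borel:
  fixes G :: "'a::euclidean_space set" and p \<delta> \<tau> :: real
  assumes John: "John_domain 1 G" and p: "1 \<le> p" and \<delta>: "0 < \<delta>" and \<tau>: "0 < \<tau>" "\<tau> < 1"
  obtains c :: real where "0 \<le> c"
    "\<And>u. u \<in> borel_measurable borel \<Longrightarrow> set_integrable lborel G u \<Longrightarrow>
      (\<integral>\<^sup>+x\<in>G. ennreal (\<bar>u x - (LINT y:G|lborel. u y) / measure lborel G\<bar> powr p) \<partial>lborel)
      \<le> ennreal c * (\<integral>\<^sup>+x\<in>G. fractional_density p (DIM('a) + \<delta> * p) \<tau> G u x \<partial>lborel)"
proof -
  obtain x0 r C L where r: "0 < r" "ball x0 r \<subseteq> G" and CL: "0 \<le> C" "0 \<le> L" and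
    bound: "\<And>u x. u \<in> borel_measurable borel \<Longrightarrow> set_integrable lborel G u \<Longrightarrow> x \<in> G \<Longrightarrow>
      ennreal (\<bar>u x - ball_mean u x0 r\<bar> powr p)
      \<le> ennreal C * (fractional_density p (DIM('a) + \<delta> * p) \<tau> G u x
        + (\<integral>\<^sup>+y. ennreal (John_kernel G L x y) * fractional_density p (DIM('a) + \<delta> * p) \<tau> G u y \<partial>lborel))"
    by (rule John_domain_pointwise_bound[OF John p \<delta> \<tau>, OF that])
  have G[measurable]: "G \<in> sets borel" and bdd: "bounded G"
    using John by (auto simp: John_domain_def)
  have fin: "emeasure lborel G \<noteq> \<infinity>"
    using emeasure_bounded_finite[OF bdd] by auto
  have pos: "0 < measure lborel G"
  proof -
    have "0 < measure lborel (ball x0 r)" using r by (intro content_ball_pos)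
    also have "\<dots> \<le> measure lborel G"
      using r fin by (intro measure_mono_fmeasurable) (auto simp: fmeasurable_def top.not_eq_extremum)
    finally show ?thesis .
  qed
  define V where "V = unit_ball_vol DIM('a) * L ^ DIM('a)"
  have V: "0 \<le> V" using CL by (simp add: V_def)
  show ?thesis
  proof (rule that[of "2 * 2 powr p * (C * (1 + V))"])
    fix u :: "'a \<Rightarrow> real" assume u[measurable]: "u \<in> borel_measurable borel" and ui: "set_integrable lborel G u"
    \<comment> \<open>Cutting the density off outside \<open>G\<close> turns its full integral into
      the right-hand side and leaves the kernel term unchanged, as the kernel vanishes for
      \<open>y\<close> outside \<open>G\<close>.\<close>
    define F where "F = (\<lambda>y. fractional_density p (DIM('a) + \<delta> * p) \<tau> G u y * indicator G y)"
    have F[measurable]: "F \<in> borel_measurable borel" unfolding F_def by measurable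
    let ?K = "\<lambda>x. \<integral>\<^sup>+y. ennreal (John_kernel G L x y) * F y \<partial>lborel"
    have KF: "?K x = (\<integral>\<^sup>+y. ennreal (John_kernel G L x y) * fractional_density p (DIM('a) + \<delta> * p) \<tau> G u y \<partial>lborel)" for x
      by (intro nn_integral_cong) (auto simp: F_def John_kernel_def split: split_indicator)
    have "(\<integral>\<^sup>+x\<in>G. ennreal (\<bar>u x - ball_mean u x0 r\<bar> powr p) \<partial>lborel)
        \<le> (\<integral>\<^sup>+x. ennreal C * (F x + ?K x) \<partial>lborel)"
    proof (intro nn_integral_mono)
      fix x
      show "ennreal (\<bar>u x - ball_mean u x0 r\<bar> powr p) * indicator G x \<le> ennreal C * (F x + ?K x)"
        using bound[OF u ui, of x] unfolding KF by (cases "x \<in> G") (auto simp: F_def)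
    qed
    also have "\<dots> = ennreal C * ((\<integral>\<^sup>+x. F x \<partial>lborel) + (\<integral>\<^sup>+x. ?K x \<partial>lborel))"
    proof -
      have [measurable]: "?K \<in> borel_measurable borel" by measurable
      show ?thesis by (simp add: nn_integral_cmult nn_integral_add)
    qed
    also have "\<dots> \<le> ennreal C * ((\<integral>\<^sup>+x. F x \<partial>lborel) + ennreal V * (\<integral>\<^sup>+x. F x \<partial>lborel))"
      unfolding V_def using CL
      by (intro mult_left_mono add_left_mono nn_integral_John_kernel_le) (auto simp: F_def)
    also have "\<dots> = ennreal (C * (1 + V)) * (\<integral>\<^sup>+x. F x \<partial>lborel)"
      using CL V by (simp add: ennreal_mult distrib_right mult.assoc)
    finally have *: "(\<integral>\<^sup>+x\<in>G. ennreal (\<bar>u x - ball_mean u x0 r\<bar> powr p) \<partial>lborel)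
        \<le> ennreal (C * (1 + V)) * (\<integral>\<^sup>+x. F x \<partial>lborel)" .
    have "(\<integral>\<^sup>+x\<in>G. ennreal (\<bar>u x - (LINT y:G|lborel. u y) / measure lborel G\<bar> powr p) \<partial>lborel)
        \<le> ennreal (2 * 2 powr p) * (\<integral>\<^sup>+x\<in>G. ennreal (\<bar>u x - ball_mean u x0 r\<bar> powr p) \<partial>lborel)"
      using G fin pos ui u by (intro nn_integral_powr_diff_mean_le p) auto
    also have "\<dots> \<le> ennreal (2 * 2 powr p) * (ennreal (C * (1 + V)) * (\<integral>\<^sup>+x. F x \<partial>lborel))"
      by (intro mult_left_mono *) auto
    also have "\<dots> = ennreal (2 * 2 powr p * (C * (1 + V))) * (\<integral>\<^sup>+x. F x \<partial>lborel)"
      using CL V by (simp add: ennreal_mult mult.assoc)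
    finally show "(\<integral>\<^sup>+x\<in>G. ennreal (\<bar>u x - (LINT y:G|lborel. u y) / measure lborel G\<bar> powr p) \<partial>lborel)
      \<le> ennreal (2 * 2 powr p * (C * (1 + V))) * (\<integral>\<^sup>+x\<in>G. fractional_density p (DIM('a) + \<delta> * p) \<tau> G u x \<partial>lborel)"
      by (simp add: F_def)
  qed (use CL V in auto)
qed

section \<open>From Borel to Lebesgue measurable functions\<close>

text \<open>On a set of finite measure |u| \<le> 1 + |u|^p is an integrable majorant.\<close>

lemma in_Lp_set_integrable:
  fixes G :: "'a::euclidean_space set"
  assumes p: "1 \<le> p" and G: "G \<in> sets lebesgue" "emeasure lebesgue G \<noteq> \<infinity>" and u: "in_Lp p G u"
  shows "set_integrable lebesgue G u"
  unfolding set_integrable_def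
proof (rule Bochner_Integration.integrable_bound)
  show "integrable lebesgue (\<lambda>x. indicator G x + indicator G x *\<^sub>R \<bar>u x\<bar> powr p :: real)"
    using u G by (intro Bochner_Integration.integrable_add) (auto simp: in_Lp_def set_integrable_def top.not_eq_extremum)
  show "(\<lambda>x. indicator G x *\<^sub>R u x) \<in> borel_measurable lebesgue"
    using u G by (simp add: in_Lp_def borel_measurable_restrict_space_iff)
  have "t \<le> 1 + t powr p" if "0 \<le> t" for t :: real
  proof (cases "t \<le> 1")
    case False
    then have "t powr 1 \<le> t powr p" using p by (intro powr_mono) auto
    then show ?thesis using False by simp
  qed (simp add: add_increasing2)
  then show "AE x in lebesgue. norm (indicator G x *\<^sub>R u x) \<le> norm (indicator G x + indicator G x *\<^sub>R \<bar>u x\<bar> powr p :: real)"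
    by (auto split: split_indicator)
qed

theorem theorem4p2:
  fixes G :: "'a::euclidean_space set"
  assumes "DIM('a) \<ge> 2"
    and "John_domain 1 G"
    and "1 \<le> p"
    and "0 < \<delta>" "\<delta> < 1"
    and "0 < \<tau>" "\<tau> < 1"
  shows "\<exists>c::real. 0 \<le> c \<and> (\<forall>u. in_Lp p G u \<longrightarrow>
     (\<integral>\<^sup>+ x \<in> G. ennreal (\<bar>u x - mean_value u G\<bar> powr p) \<partial>lebesgue)
       \<le> ennreal c * (\<integral>\<^sup>+ x \<in> G. (\<integral>\<^sup>+ y \<in> G \<inter> ball x (\<tau> * infdist x (frontier G)).
            ennreal (\<bar>u x - u y\<bar> powr p / dist x y powr (real DIM('a) + \<delta> * p)) \<partial>lebesgue) \<partial>lebesgue))"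
proof -
  have G: "G \<in> sets borel" and bdd: "bounded G"
    using assms by (auto simp: John_domain_def)
  have fin: "emeasure lborel G \<noteq> \<infinity>"
    using emeasure_bounded_finite[OF bdd] by auto
  obtain c where c: "0 \<le> c" "\<And>u. u \<in> borel_measurable borel \<Longrightarrow> set_integrable lborel G u \<Longrightarrow>
      (\<integral>\<^sup>+x\<in>G. ennreal (\<bar>u x - (LINT y:G|lborel. u y) / measure lborel G\<bar> powr p) \<partial>lborel)
      \<le> ennreal c * (\<integral>\<^sup>+x\<in>G. fractional_density p (DIM('a) + \<delta> * p) \<tau> G u x \<partial>lborel)"
    by (rule fractional_Poincare_borel[OF assms(2,3,4,6,7), OF that])
  show ?thesis
  proof (intro exI[of _ c] conjI allI impI)
    fix u assume u: "in_Lp p G u"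
    have ui: "integrable lebesgue (\<lambda>x. indicator G x *\<^sub>R u x)"
      using in_Lp_set_integrable[OF assms(3) _ _ u] G fin by (simp add: set_integrable_def)
    \<comment> \<open>A Borel representative of \<open>u\<close> cut off by \<open>G\<close>, since
      \<open>u\<close> is controlled only on \<open>G\<close>.\<close>
    obtain w where w: "w \<in> borel_measurable lborel" and ae: "AE x in lborel. indicator G x *\<^sub>R u x = w x"
      using completion_ex_borel_measurable_real[OF borel_measurable_integrable[OF ui]] by blast
    have ae': "AE x in lborel. x \<in> G \<longrightarrow> u x = w x"
      using ae by eventually_elim (auto split: split_indicator)
    have "integrable lebesgue w"
      using ui by (rule integrable_cong_AE_imp) (use w ae in \<open>auto intro!: measurable_completion AE_completion simp: eq_commute\<close>)
    then have "integrable lborel w"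
      using w by (simp add: integrable_completion)
    then have wi: "set_integrable lborel G w"
      unfolding set_integrable_def using G by (intro integrable_mult_indicator) auto
    have "(LINT x:G|lebesgue. u x) = (LINT x:G|lebesgue. w x)"
      unfolding set_lebesgue_integral_def
      using ui w G ae' by (intro integral_cong_AE)
        (auto intro!: AE_completion measurable_completion elim!: eventually_mono split: split_indicator)
    also have "\<dots> = (LINT x:G|lborel. w x)"
      unfolding set_lebesgue_integral_def using w G by (intro integral_completion) auto
    finally have mean: "mean_value u G = (LINT y:G|lborel. w y) / measure lborel G"
      using G by (simp add: mean_value_def)
    have "(\<integral>\<^sup>+ x \<in> G. ennreal (\<bar>u x - mean_value u G\<bar> powr p) \<partial>lebesgue)
        = (\<integral>\<^sup>+x\<in>G. ennreal (\<bar>w x - (LINT y:G|lborel. w y) / measure lborel G\<bar> powr p) \<partial>lborel)"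
      \<comment> \<open>Nonnegative integrals over a measure and its completion agree for every
        function, so only the almost everywhere equality of \<open>u\<close> and \<open>w\<close> on
        \<open>G\<close> remains to be used.\<close>
      unfolding nn_integral_completion mean
      by (rule nn_integral_cong_AE) (use ae' in \<open>auto elim!: eventually_mono split: split_indicator\<close>)
    also have "\<dots> \<le> ennreal c * (\<integral>\<^sup>+x\<in>G. fractional_density p (DIM('a) + \<delta> * p) \<tau> G w x \<partial>lborel)"
      using w wi by (intro c) auto
    also have "(\<integral>\<^sup>+x\<in>G. fractional_density p (DIM('a) + \<delta> * p) \<tau> G w x \<partial>lborel)
        = (\<integral>\<^sup>+ x \<in> G. (\<integral>\<^sup>+ y \<in> G \<inter> ball x (\<tau> * infdist x (frontier G)).
            ennreal (\<bar>u x - u y\<bar> powr p / dist x y powr (real DIM('a) + \<delta> * p)) \<partial>lebesgue) \<partial>lebesgue)"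
      unfolding nn_integral_completion fractional_density_def
    \<comment> \<open>The exchange is made twice: for almost every \<open>x\<close> in the outer
      integral, and for each such \<open>x\<close> in \<open>G\<close> for almost every
      \<open>y\<close> in the inner one.\<close>
    proof (rule nn_integral_cong_AE, use ae' in eventually_elim)
      fix x assume x: "x \<in> G \<longrightarrow> u x = w x"
      show "(\<integral>\<^sup>+y\<in>G \<inter> ball x (\<tau> * infdist x (frontier G)).
            ennreal (\<bar>w x - w y\<bar> powr p / dist x y powr (real DIM('a) + \<delta> * p)) \<partial>lborel) * indicator G x
        = (\<integral>\<^sup>+y\<in>G \<inter> ball x (\<tau> * infdist x (frontier G)).
            ennreal (\<bar>u x - u y\<bar> powr p / dist x y powr (real DIM('a) + \<delta> * p)) \<partial>lborel) * indicator G x"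
      proof (cases "x \<in> G")
        case True
        with x have "u x = w x" by simp
        then show ?thesis
          by (intro arg_cong2[where f="(*)"] refl nn_integral_cong_AE)
            (use ae' in \<open>auto elim!: eventually_mono split: split_indicator\<close>)
      qed simp
    qed
    finally show "(\<integral>\<^sup>+ x \<in> G. ennreal (\<bar>u x - mean_value u G\<bar> powr p) \<partial>lebesgue)
       \<le> ennreal c * (\<integral>\<^sup>+ x \<in> G. (\<integral>\<^sup>+ y \<in> G \<inter> ball x (\<tau> * infdist x (frontier G)).
            ennreal (\<bar>u x - u y\<bar> powr p / dist x y powr (real DIM('a) + \<delta> * p)) \<partial>lebesgue) \<partial>lebesgue)" .
  qed (fact c(1))
qed

end
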